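(* Let $G\neq\emptyset$ be a set. The structure $(\mathrm{Tab}(G),\Join,\emptyset,\{\langle\rangle\},\cdot,(E_{xy})_{x,y\in\mathbf{var}},\mathrm{schema})$ is an orbital semilattice.
   Context: **Partial transformations.** $\mathbf{var}=\{x_1,x_2,x_3,\dots\}$ is a fixed countably infinite set of variables (enumerated without repetition); $\mathfrak{P}(\mathbf{var})$ is its power set and $\mathfrak{P}_{\mathrm{fin}}(\mathbf{var})$ the set of its finite subsets. For a partial function $f$, $\mathrm{def}(f)$ is its domain of definition, $\mathrm{rng}(f)$ its range, and $f^{-1}(Z)=\{a\in\mathrm{def}(f)\mid f(a)\in Z\}$. $\mathcal{T}_{\mathrm{fp}}(\mathbf{var})$ is the set of partial functions $f:\mathbf{var}\rightharpoonup\mathbf{var}$ with $\mathrm{def}(f)$ finite. Composition $\mu\circ\lambda$ is relational: $\mathrm{def}(\mu\circ\lambda)=\lambda^{-1}(\mathrm{def}(\mu))$ and $(\mu\circ\lambda)(x)=\mu(\lambda(x))$. $\pi_X$ is the identity on $X\subseteq\mathbf{var}$, regarded as a partial function. $\tfrac{z_1\dots z_n}{y_1\dots y_n}$ is the function with domain $\{y_1,\dots,y_n\}$ and $y_i\mapsto z_i$ (so $\tfrac{xx}{xy}$ is the function $\{x,y\}\to\{x\}$, also when $x=y$). **Orbital semilattice.** A structure $(V,\wedge,0,1,\cdot,(d_{xy})_{x,y\in\mathbf{var}},\mathrm{dom})$ where $(V,\wedge,0,1)$ is a bounded meet-semilattice with bottom $0$ and top $1$ (order: $u\le v\Leftrightarrow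 u\wedge v=u$), $\cdot:V\times\mathcal{T}_{\mathrm{fp}}(\mathbf{var})\to V$, $d_{xy}\in V$, $\mathrm{dom}:V\to\mathfrak{P}(\mathbf{var})$, such that for all $u,v\in V$, $\lambda,\mu\in\mathcal{T}_{\mathrm{fp}}(\mathbf{var})$, $x,y\in\mathbf{var}$, $Y\in\mathfrak{P}_{\mathrm{fin}}(\mathbf{var})$ (with $\cdot$ binding stronger than $\wedge$): (A1) $u\ne0\Rightarrow u\cdot\pi_\emptyset=1$; (A2) $0\cdot\lambda=0$; (A3) $\mathrm{dom}(u)\subseteq Y\Rightarrow(u\wedge v)\cdot\pi_Y=u\wedge v\cdot\pi_Y$; (A4) $u\le u\cdot\pi_Y$; (A5) $u\le v\Rightarrow u\cdot\lambda\le v\cdot\lambda$; (A6) $(0\ne u\le d_{xy}$ and $x\ne y)\Rightarrow u=(u\cdot\pi_{\mathrm{dom}(u)\setminus\{y\}})\wedge d_{xy}$; (A7) $(u\cdot\lambda)\cdot\mu=u\cdot(\lambda\circ\mu)$; (A8) $u\cdot\pi_{\mathrm{dom}(u)}=u$; (A9) $d_{xx}\ne0$; (A10) $d_{xy}=d_{xx}\cdot\tfrac{xx}{xy}$; (A11) $u\ne0\Rightarrow\mathrm{dom}(u\cdot\lambda)=\lambda^{-1}(\mathrm{dom}(u))$; (A12) $u\ne0\Rightarrow\mathrm{dom}(u)$ is finite; (A13) $\mathrm{dom}(u)=\{x\in\mathbf{var}\mid u\le d_{xx}\}$. By convention $w\cdot\pi_{\mathbf{var}}:=w$ for $w\in V$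 (relevant to (A8) for $u=0$, as $\mathrm{dom}(0)=\mathbf{var}$). **Table algebra.** $\mathrm{Tab}(G):=\bigcup_{X\in\mathfrak{P}_{\mathrm{fin}}(\mathbf{var})}\mathfrak{P}(G^X)$, i.e. a table is a set $T\subseteq G^X$ for some finite $X\subseteq\mathbf{var}$. $\mathrm{schema}(T):=X$ if $\emptyset\neq T\subseteq G^X$, and $\mathrm{schema}(\emptyset):=\mathbf{var}$. $T_1\Join T_2:=\{t\in G^{\mathrm{schema}(T_1)\cup\mathrm{schema}(T_2)}\mid t|_{\mathrm{schema}(T_1)}\in T_1,\ t|_{\mathrm{schema}(T_2)}\in T_2\}$. $\langle\rangle$ is the empty tuple. $T\cdot\lambda:=\{t\circ\lambda\mid t\in T\}$ for $\lambda\in\mathcal{T}_{\mathrm{fp}}(\mathbf{var})$. $E_{xy}:=\{t\in G^{\{x,y\}}\mid t(x)=t(y)\}$. *)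

theory Defs
  imports Main
begin

datatype var = Var nat

type_synonym ptrans = "var \<rightharpoonup> var"

definition Tfp :: "ptrans set" where
  "Tfp = {f. finite (dom f)}"

(* Composition of partial functions is map composition, and the inverse image
   f^{-1}(Z) under a partial function f is written f -` Some ` Z. *)

definition pid :: "var set \<Rightarrow> ptrans" (\<open>\<pi>\<close>) where
  "\<pi> X = Some |` X"

locale bounded_meet_semilattice =
  fixes V :: "'a set"
    and meet :: "'a \<Rightarrow> 'a \<Rightarrow> 'a" (infixl \<open>\<sqinter>\<close> 70)
    and zero :: 'a (\<open>\<zero>\<close>)
    and one :: 'a (\<open>\<one>\<close>)
  assumes zero_closed: "\<zero> \<in> V"
    and one_closed: "\<one> \<in> V"
    and meet_closed: "\<lbrakk>u \<in> V; v \<in> V\<rbrakk> \<Longrightarrow> u \<sqinter> v \<in> V"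
    and meet_assoc: "\<lbrakk>u \<in> V; v \<in> V; w \<in> V\<rbrakk> \<Longrightarrow> (u \<sqinter> v) \<sqinter> w = u \<sqinter> (v \<sqinter> w)"
    and meet_commute: "\<lbrakk>u \<in> V; v \<in> V\<rbrakk> \<Longrightarrow> u \<sqinter> v = v \<sqinter> u"
    and meet_idem: "u \<in> V \<Longrightarrow> u \<sqinter> u = u"
    and zero_meet: "u \<in> V \<Longrightarrow> \<zero> \<sqinter> u = \<zero>"
    and one_meet: "u \<in> V \<Longrightarrow> \<one> \<sqinter> u = u"
begin

abbreviation le :: "'a \<Rightarrow> 'a \<Rightarrow> bool" (infix \<open>\<sqsubseteq>\<close> 50) where
  "u \<sqsubseteq> v \<equiv> u \<sqinter> v = u"

end

(* In A8 the case split is the convention u \<cdot> \<pi> UNIV := u: the map \<pi> UNIV is not in Tfp,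
   so the action on it is unconstrained. It matters only for u = \<zero>, where A13 forces
   dm \<zero> = UNIV. In A6 the map is in Tfp by A12. *)
locale orbital_semilattice = bounded_meet_semilattice V meet zero one
  for V :: "'a set"
    and meet :: "'a \<Rightarrow> 'a \<Rightarrow> 'a" (infixl \<open>\<sqinter>\<close> 70)
    and zero :: 'a (\<open>\<zero>\<close>)
    and one :: 'a (\<open>\<one>\<close>) +
  fixes act :: "'a \<Rightarrow> ptrans \<Rightarrow> 'a" (infixl \<open>\<cdot>\<close> 75)
    and d :: "var \<Rightarrow> var \<Rightarrow> 'a"
    and dm :: "'a \<Rightarrow> var set"
  assumes act_closed: "\<lbrakk>u \<in> V; f \<in> Tfp\<rbrakk> \<Longrightarrow> u \<cdot> f \<in> V"
    and d_closed: "d x y \<in> V"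
    and A1: "\<lbrakk>u \<in> V; u \<noteq> \<zero>\<rbrakk> \<Longrightarrow> u \<cdot> \<pi> {} = \<one>"
    and A2: "f \<in> Tfp \<Longrightarrow> \<zero> \<cdot> f = \<zero>"
    and A3: "\<lbrakk>u \<in> V; v \<in> V; finite Y; dm u \<subseteq> Y\<rbrakk> \<Longrightarrow> (u \<sqinter> v) \<cdot> \<pi> Y = u \<sqinter> v \<cdot> \<pi> Y"
    and A4: "\<lbrakk>u \<in> V; finite Y\<rbrakk> \<Longrightarrow> u \<sqsubseteq> u \<cdot> \<pi> Y"
    and A5: "\<lbrakk>u \<in> V; v \<in> V; f \<in> Tfp; u \<sqsubseteq> v\<rbrakk> \<Longrightarrow> u \<cdot> f \<sqsubseteq> v \<cdot> f"
    and A6: "\<lbrakk>u \<in> V; u \<noteq> \<zero>; u \<sqsubseteq> d x y; x \<noteq> y\<rbrakk> \<Longrightarrow> u = (u \<cdot> \<pi> (dm u - {y})) \<sqinter> d x y"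
    and A7: "\<lbrakk>u \<in> V; f \<in> Tfp; g \<in> Tfp\<rbrakk> \<Longrightarrow> (u \<cdot> f) \<cdot> g = u \<cdot> (f \<circ>\<^sub>m g)"
    and A8: "u \<in> V \<Longrightarrow> (if dm u = UNIV then u else u \<cdot> \<pi> (dm u)) = u"
    and A9: "d x x \<noteq> \<zero>"
    and A10: "d x y = d x x \<cdot> [x \<mapsto> x, y \<mapsto> x]"
    and A11: "\<lbrakk>u \<in> V; u \<noteq> \<zero>; f \<in> Tfp\<rbrakk> \<Longrightarrow> dm (u \<cdot> f) = f -` Some ` dm u"
    and A12: "\<lbrakk>u \<in> V; u \<noteq> \<zero>\<rbrakk> \<Longrightarrow> finite (dm u)"
    and A13: "u \<in> V \<Longrightarrow> dm u = {x. u \<sqsubseteq> d x x}"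

(* Tuples are partial functions rather than extensional total ones, so that a tuple
   determines its own schema. *)

type_synonym 'g tuple = "var \<rightharpoonup> 'g"

definition tuples :: "'g set \<Rightarrow> var set \<Rightarrow> 'g tuple set" where
  "tuples G X = {t. dom t = X \<and> ran t \<subseteq> G}"

definition Tab :: "'g set \<Rightarrow> 'g tuple set set" where
  "Tab G = (\<Union>X\<in>{X. finite X}. Pow (tuples G X))"

definition schema :: "'g set \<Rightarrow> 'g tuple set \<Rightarrow> var set" where
  "schema G T = (if T = {} then UNIV else (THE X. T \<subseteq> tuples G X))"

definition join :: "'g set \<Rightarrow> 'g tuple set \<Rightarrow> 'g tuple set \<Rightarrow> 'g tuple set" where
  "join G T\<^sub>1 T\<^sub>2 = {t \<in> tuples G (schema G T\<^sub>1 \<union> schema G T\<^sub>2).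
     t |` schema G T\<^sub>1 \<in> T\<^sub>1 \<and> t |` schema G T\<^sub>2 \<in> T\<^sub>2}"

definition tab_act :: "'g tuple set \<Rightarrow> ptrans \<Rightarrow> 'g tuple set" where
  "tab_act T f = {t \<circ>\<^sub>m f | t. t \<in> T}"

definition diag :: "'g set \<Rightarrow> var \<Rightarrow> var \<Rightarrow> 'g tuple set" where
  "diag G x y = {t \<in> tuples G {x, y}. t x = t y}"

end

theory Submission
  imports Defs
begin

text \<open>A table over X is a set of partial functions with domain X. For such tables the natural
  join consists of the partial functions on the union of the two domains whose restrictions lie in
  the two factors (\<open>join_eq\<close>), so the semilattice laws reduce to facts about
  restriction. For nonempty tables, T \<le> S says that S has fewer columns and every tuple of T
  restricts into S (\<open>join_le_iff\<close>). This turns A4, A5, A13 and the hypothesis of A6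
  into checks on single tuples. The action is precomposition: A7 is associativity of composition,
  and A11 reads off the domain of a composite.

  Three axioms need a construction. A3 glues two tuples that agree on their overlap
  (\<open>join_tab_act_pid\<close>). In A6, deleting column y loses nothing, since its entry is
  still stored at x. A10 copies column x to y (\<open>diag_conv_tab_act\<close>). The empty table,
  with schema \<open>UNIV\<close>, is treated separately wherever the schema of a table is
  needed.\<close>

section \<open>Tuples, tables and schemas\<close>

lemma tuplesI: "dom t = X \<Longrightarrow> ran t \<subseteq> G \<Longrightarrow> t \<in> tuples G X"
  by (simp add: tuples_def)

lemma tuples_dom: "t \<in> tuples G X \<Longrightarrow> dom t = X"
  by (simp add: tuples_def)

lemma tuples_ran: "t \<in> tuples G X \<Longrightarrow> ran t \<subseteq> G"
  by (simp add: tuples_def)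

lemma TabI: "finite X \<Longrightarrow> T \<subseteq> tuples G X \<Longrightarrow> T \<in> Tab G"
  by (auto simp: Tab_def)

lemma TabE:
  assumes "T \<in> Tab G"
  obtains X where "finite X" "T \<subseteq> tuples G X"
  using assms by (auto simp: Tab_def)

lemma schema_empty: "schema G {} = UNIV"
  by (simp add: schema_def)

text \<open>The domain of any single tuple already determines X, so the definite description is well
  defined on nonempty tables.\<close>

lemma schema_eq: "T \<noteq> {} \<Longrightarrow> T \<subseteq> tuples G X \<Longrightarrow> schema G T = X"
  by (auto simp: schema_def tuples_def intro!: the_equality)

section \<open>Natural join and its order\<close>

lemma join_empty: "join G {} T = {}" "join G T {} = {}"
  by (simp_all add: join_def)

lemma restrict_map_dom: "dom t = X \<Longrightarrow> t |` X = t"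
  by (auto simp: restrict_map_def fun_eq_iff domIff)

text \<open>Since the right-hand side does not mention the schemas, it is also correct for empty
  tables, whose schema is \<^term>\<open>UNIV\<close>.\<close>

lemma join_eq:
  assumes T: "T \<subseteq> tuples G X" and S: "S \<subseteq> tuples G Y"
  shows "join G T S = {t. dom t = X \<union> Y \<and> t |` X \<in> T \<and> t |` Y \<in> S}"
proof (cases "T = {} \<or> S = {}")
  case True
  then show ?thesis by (auto simp: join_empty)
next
  case False
  then have "schema G T = X" "schema G S = Y"
    using T S by (simp_all add: schema_eq)
  \<comment> \<open>Every entry of t lies in column set X or Y, hence is an entry of one of the two
    restrictions, which are tuples over G.\<close>
  moreover have "ran t \<subseteq> G" if "dom t = X \<union> Y" "t |` X \<in> T" "t |` Y \<in> S" for t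
  proof
    fix b assume "b \<in> ran t"
    then obtain a where a: "t a = Some b" by (auto simp: ran_def)
    then have "a \<in> X \<or> a \<in> Y" using that(1) by blast
    then have "b \<in> ran (t |` X) \<or> b \<in> ran (t |` Y)"
      using a by (auto intro: ranI[of _ a])
    moreover have "ran (t |` X) \<subseteq> G" "ran (t |` Y) \<subseteq> G"
      using that T S tuples_ran by blast+
    ultimately show "b \<in> G" by auto
  qed
  ultimately show ?thesis
    by (auto simp: join_def tuples_def)
qed

lemma join_subset:
  assumes "T \<subseteq> tuples G X" "S \<subseteq> tuples G Y"
  shows "join G T S \<subseteq> tuples G (X \<union> Y)"
  using assms by (cases "T = {} \<or> S = {}") (auto simp: join_empty join_def schema_eq)

lemma Collect_restrict_mem:
  assumes "T \<subseteq> tuples G X"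
  shows "{t. dom t = X \<and> t |` X \<in> T} = T"
proof (intro equalityI subsetI)
  fix t assume "t \<in> {t. dom t = X \<and> t |` X \<in> T}"
  then show "t \<in> T" using restrict_map_dom[of t X] by simp
next
  fix t assume "t \<in> T"
  moreover from this have "dom t = X" using assms tuples_dom by blast
  ultimately show "t \<in> {t. dom t = X \<and> t |` X \<in> T}"
    using restrict_map_dom[of t X] by simp
qed

text \<open>Tuples of the join have domain X \<union> Y, so equality with a nonempty T forces Y
  \<subseteq> X; after that the join merely selects the tuples of T that restrict into S.
  Nonemptiness matters: the empty table lies below every table, whatever the columns.\<close>

lemma join_le_iff:
  assumes T: "T \<subseteq> tuples G X" "T \<noteq> {}" and S: "S \<subseteq> tuples G Y"
  shows "join G T S = T \<longleftrightarrow> Y \<subseteq> X \<and> (\<forall>t\<in>T. t |` Y \<in> S)"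
proof
  assume eq: "join G T S = T"
  from T(2) obtain t where "t \<in> T" by blast
  then have "dom t = X \<union> Y" "dom t = X"
    using eq join_eq[OF T(1) S] T(1) tuples_dom by blast+
  then show "Y \<subseteq> X \<and> (\<forall>t\<in>T. t |` Y \<in> S)"
    using eq join_eq[OF T(1) S] by blast
next
  assume le: "Y \<subseteq> X \<and> (\<forall>t\<in>T. t |` Y \<in> S)"
  then have "X \<union> Y = X" by blast
  then have "join G T S = {t. dom t = X \<and> t |` X \<in> T} \<inter> {t. t |` Y \<in> S}"
    unfolding join_eq[OF T(1) S] by auto
  also have "\<dots> = T"
    unfolding Collect_restrict_mem[OF T(1)] using le by blast
  finally show "join G T S = T" .
qed

section \<open>Action by precomposition\<close>

lemma map_comp_pid: "t \<circ>\<^sub>m \<pi> Y = t |` Y"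
  by (auto simp: pid_def map_comp_def restrict_map_def fun_eq_iff)

lemma map_comp_assoc: "(f \<circ>\<^sub>m g) \<circ>\<^sub>m h = f \<circ>\<^sub>m (g \<circ>\<^sub>m h)"
  by (auto simp: map_comp_def fun_eq_iff split: option.splits)

lemma dom_map_comp: "dom (t \<circ>\<^sub>m f) = f -` Some ` dom t"
  by (auto simp: map_comp_def dom_def split: option.splits)

lemma finite_vimage_Tfp: "f \<in> Tfp \<Longrightarrow> finite (f -` Some ` X)"
  unfolding Tfp_def by (rule finite_subset[of _ "dom f"]) auto

lemma vimage_pid: "\<pi> Y -` Some ` X = X \<inter> Y"
  by (auto simp: pid_def restrict_map_def split: if_splits)

lemma tab_act_eq: "tab_act T f = (\<lambda>t. t \<circ>\<^sub>m f) ` T"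
  by (auto simp: tab_act_def)

lemma tab_act_pid: "tab_act T (\<pi> Y) = (\<lambda>t. t |` Y) ` T"
  by (simp add: tab_act_eq map_comp_pid)

lemma tab_act_subset:
  assumes "T \<subseteq> tuples G X"
  shows "tab_act T f \<subseteq> tuples G (f -` Some ` X)"
proof -
  have "t \<circ>\<^sub>m f \<in> tuples G (f -` Some ` X)" if "t \<in> T" for t
  proof (rule tuplesI)
    have t: "t \<in> tuples G X" using that assms by blast
    show "dom (t \<circ>\<^sub>m f) = f -` Some ` X"
      using tuples_dom[OF t] by (simp add: dom_map_comp)
    show "ran (t \<circ>\<^sub>m f) \<subseteq> G"
      using tuples_ran[OF t] by (fastforce simp: ran_def map_comp_Some_iff)
  qed
  then show ?thesis by (auto simp: tab_act_eq)
qed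

lemma tab_act_pid_subset: "T \<subseteq> tuples G X \<Longrightarrow> tab_act T (\<pi> Y) \<subseteq> tuples G (X \<inter> Y)"
  using tab_act_subset[of T G X "\<pi> Y"] by (simp add: vimage_pid)

lemma tab_act_empty: "tab_act {} f = {}"
  by (simp add: tab_act_eq)

section \<open>Equality tables\<close>

lemma diag_subset: "diag G x y \<subseteq> tuples G {x, y}"
  by (auto simp: diag_def)

lemma diag_refl: "diag G x x = tuples G {x}"
  by (auto simp: diag_def)

lemma restrict_map_tuples: "t \<in> tuples G X \<Longrightarrow> Y \<subseteq> X \<Longrightarrow> t |` Y \<in> tuples G Y"
  by (auto simp: tuples_def ran_def restrict_map_def split: if_splits)

section \<open>Associativity, projection of a join, duplication of a column\<close>

text \<open>Both bracketings equal the symmetric threefold join: all partial functions on the union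
  of the three domains that restrict into each factor.\<close>

lemma join_assoc:
  assumes T: "T \<subseteq> tuples G X" and S: "S \<subseteq> tuples G Y" and R: "R \<subseteq> tuples G Z"
  shows "join G (join G T S) R = join G T (join G S R)"
proof -
  have "join G (join G T S) R = {t. dom t = X \<union> Y \<union> Z \<and> t |` X \<in> T \<and> t |` Y \<in> S \<and> t |` Z \<in> R}"
  proof -
    \<comment> \<open>Successive restrictions restrict to the intersection; these identities
      collapse them.\<close>
    have "(X \<union> Y) \<inter> X = X" "(X \<union> Y) \<inter> Y = Y" "(X \<union> Y \<union> Z) \<inter> (X \<union> Y) = X \<union> Y"
      by blast+
    then show ?thesis
      by (subst join_eq[OF join_subset[OF T S] R], subst join_eq[OF T S])
        (rule Collect_cong, auto)
  qed
  moreover have "join G T (join G S R) = {t. dom t = X \<union> (Y \<union> Z) \<and> t |` X \<in> T \<and> t |` Y \<in> S \<and> t |` Z \<in> R}"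
  proof -
    have "(Y \<union> Z) \<inter> Y = Y" "(Y \<union> Z) \<inter> Z = Z" "(X \<union> (Y \<union> Z)) \<inter> (Y \<union> Z) = Y \<union> Z"
      by blast+
    then show ?thesis
      by (subst join_eq[OF T join_subset[OF S R]], subst join_eq[OF S R])
        (rule Collect_cong, auto)
  qed
  ultimately show ?thesis by (simp add: Un_assoc)
qed

text \<open>This is A3. Since X \<subseteq> Y, projecting to Y can only drop columns of S outside X.
  Conversely, a tuple of the right-hand join extends to the dropped columns through any tuple of S
  that projects to its part on Z \<inter> Y.\<close>

lemma join_tab_act_pid:
  assumes T: "T \<subseteq> tuples G X" and S: "S \<subseteq> tuples G Z" and Y: "X \<subseteq> Y"
  shows "tab_act (join G T S) (\<pi> Y) = join G T (tab_act S (\<pi> Y))"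
proof -
  have "join G T ((\<lambda>t. t |` Y) ` S) =
      {t. dom t = X \<union> Z \<inter> Y \<and> t |` X \<in> T \<and> t |` (Z \<inter> Y) \<in> (\<lambda>t. t |` Y) ` S}"
    using join_eq[OF T tab_act_pid_subset[OF S, of Y]] by (simp only: tab_act_pid)
  moreover have "(\<lambda>t. t |` Y) ` {t. dom t = X \<union> Z \<and> t |` X \<in> T \<and> t |` Z \<in> S} =
      {t. dom t = X \<union> Z \<inter> Y \<and> t |` X \<in> T \<and> t |` (Z \<inter> Y) \<in> (\<lambda>t. t |` Y) ` S}"
  proof (intro equalityI subsetI)
    fix t assume "t \<in> (\<lambda>t. t |` Y) ` {t. dom t = X \<union> Z \<and> t |` X \<in> T \<and> t |` Z \<in> S}"
    then obtain r where r: "t = r |` Y" "dom r = X \<union> Z" "r |` X \<in> T" "r |` Z \<in> S"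
      by blast
    have "Y \<inter> X = X" "(X \<union> Z) \<inter> Y = X \<union> Z \<inter> Y" using Y by blast+
    moreover have "t |` (Z \<inter> Y) \<in> (\<lambda>t. t |` Y) ` S"
      by (rule image_eqI[OF _ r(4)]) (auto simp: r(1) fun_eq_iff restrict_map_def)
    ultimately show "t \<in> {t. dom t = X \<union> Z \<inter> Y \<and> t |` X \<in> T \<and> t |` (Z \<inter> Y) \<in> (\<lambda>t. t |` Y) ` S}"
      using r(1-3) by simp
  next
    fix t assume "t \<in> {t. dom t = X \<union> Z \<inter> Y \<and> t |` X \<in> T \<and> t |` (Z \<inter> Y) \<in> (\<lambda>t. t |` Y) ` S}"
    then obtain s where t: "dom t = X \<union> Z \<inter> Y" "t |` X \<in> T"
      and s: "s \<in> S" "t |` (Z \<inter> Y) = s |` Y" by blast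
    have ds: "dom s = Z" using s(1) S tuples_dom by blast
    have agree: "t x = s x" if "x \<in> Z" "x \<in> Y" for x
      using fun_cong[OF s(2), of x] that by simp
    \<comment> \<open>The glued tuple: t where it is defined, and s on the columns of Z outside Y.
      It restricts to s on Z because t lives inside Y and agrees there with s on Z.\<close>
    define r where "r = s ++ t"
    have "dom r = X \<union> Z" using t(1) ds by (auto simp: r_def)
    moreover have "r |` X = t |` X"
      using t(1) by (auto simp: r_def fun_eq_iff restrict_map_def map_add_def split: option.splits)
    moreover have "r |` Z = s"
    proof
      fix x
      show "(r |` Z) x = s x"
      proof (cases "x \<in> Z")
        case True
        show ?thesis
        proof (cases "t x")
          case None
          then show ?thesis using True by (simp add: r_def map_add_def)
        next
          case (Some b)
          then have "x \<in> Y" using t(1) Y by blast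
          then show ?thesis using True Some agree[of x] by (simp add: r_def map_add_def)
        qed
      next
        case False
        then show ?thesis using ds by auto
      qed
    qed
    moreover have "r |` Y = t"
    proof
      fix x
      show "(r |` Y) x = t x"
      proof (cases "x \<in> Y")
        case True
        show ?thesis
        proof (cases "t x")
          case None
          then have "x \<notin> Z" using t(1) True by blast
          then have "s x = None" using ds by blast
          then show ?thesis using True None by (simp add: r_def map_add_def)
        next
          case (Some b)
          then show ?thesis using True by (simp add: r_def map_add_def)
        qed
      next
        case False
        then have "t x = None" using t(1) Y by blast
        then show ?thesis using False by simp
      qed
    qed
    ultimately show "t \<in> (\<lambda>t. t |` Y) ` {t. dom t = X \<union> Z \<and> t |` X \<in> T \<and> t |` Z \<in> S}"
      using t(2) s(1) by (intro image_eqI[of _ _ r]) auto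
  qed
  ultimately show ?thesis
    by (simp only: tab_act_pid join_eq[OF T S])
qed

text \<open>A tuple with equal entries at x and y is its own x-entry, copied to y by precomposition;
  the case x = y is included.\<close>

lemma diag_conv_tab_act: "diag G x y = tab_act (diag G x x) [x \<mapsto> x, y \<mapsto> x]"
proof (intro equalityI subsetI)
  fix t assume t: "t \<in> diag G x y"
  then have d: "dom t = {x, y}" "t x = t y" by (auto simp: diag_def tuples_def)
  have mem: "t |` {x} \<in> diag G x x"
    using t by (auto simp: diag_def intro: restrict_map_tuples)
  have eq: "t = (t |` {x}) \<circ>\<^sub>m [x \<mapsto> x, y \<mapsto> x]"
  proof
    fix z
    show "t z = ((t |` {x}) \<circ>\<^sub>m [x \<mapsto> x, y \<mapsto> x]) z"
      using d by (cases "z \<in> {x, y}") (auto simp: map_comp_def)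
  qed
  show "t \<in> tab_act (diag G x x) [x \<mapsto> x, y \<mapsto> x]"
    unfolding tab_act_eq by (rule image_eqI[OF _ mem]) (rule eq)
next
  fix t assume "t \<in> tab_act (diag G x x) [x \<mapsto> x, y \<mapsto> x]"
  then obtain s where s: "s \<in> tuples G {x}" and t: "t = s \<circ>\<^sub>m [x \<mapsto> x, y \<mapsto> x]"
    by (auto simp: tab_act_eq diag_refl)
  have "[x \<mapsto> x, y \<mapsto> x] -` Some ` {x} = {x, y}"
    by (auto split: if_splits)
  \<comment> \<open>Passing to a singleton table lets the schema bound for tables apply to one
    tuple.\<close>
  moreover have "t \<in> tab_act {s} [x \<mapsto> x, y \<mapsto> x]"
    by (simp add: tab_act_eq t)
  ultimately have "t \<in> tuples G {x, y}"
    using tab_act_subset[of "{s}" G "{x}" "[x \<mapsto> x, y \<mapsto> x]"] s by auto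
  then show "t \<in> diag G x y"
    by (simp add: diag_def t map_comp_def)
qed

section \<open>Verification of the axioms\<close>

theorem theorem1:
  fixes G :: "'g set"
  assumes "G \<noteq> {}"
  shows "orbital_semilattice (Tab G) (join G) {} {Map.empty} tab_act (diag G) (schema G)"
proof unfold_locales
  have one: "{Map.empty} \<subseteq> tuples G {}" by (simp add: tuples_def)
  show "{} \<in> Tab G" by (rule TabI[of "{}"]) auto
  show "{Map.empty} \<in> Tab G" by (rule TabI[OF _ one]) simp
  show "diag G x y \<in> Tab G" for x y
    by (rule TabI[OF _ diag_subset]) simp
  show "tab_act {} f = {}" for f by (rule tab_act_empty)
  show "diag G x y = tab_act (diag G x x) [x \<mapsto> x, y \<mapsto> x]" for x y
    by (rule diag_conv_tab_act)
  show "diag G x x \<noteq> {}" for x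
  proof -
    \<comment> \<open>An element of G supplies a one-column tuple.\<close>
    from assms obtain g where "g \<in> G" by blast
    then have "[x \<mapsto> g] \<in> tuples G {x}" by (simp add: tuples_def)
    then show ?thesis by (auto simp: diag_refl)
  qed

  fix u assume u: "u \<in> Tab G"
  then obtain X where X: "finite X" "u \<subseteq> tuples G X" by (rule TabE)
  have schema_u: "u \<noteq> {} \<Longrightarrow> schema G u = X"
    using X(2) by (simp add: schema_eq)
  have u_dom: "dom t = X" "t |` X = t" if "t \<in> u" for t
    using that X(2) tuples_dom restrict_map_dom by blast+
  show "join G u u = u"
    using join_le_iff[OF X(2) _ X(2)] u_dom by (cases "u = {}") (auto simp: join_empty)
  show "join G {} u = {}" by (rule join_empty)
  show "join G {Map.empty} u = u"
    unfolding join_eq[OF one X(2)] using Collect_restrict_mem[OF X(2)] by simp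
  show "u \<noteq> {} \<Longrightarrow> tab_act u (\<pi> {}) = {Map.empty}"
    by (auto simp: tab_act_pid)
  show "join G u (tab_act u (\<pi> Y)) = u" if "finite Y" for Y
  proof (cases "u = {}")
    case False
    \<comment> \<open>As t has domain X, restricting it to X \<inter> Y or to Y gives the same
      tuple.\<close>
    have "t |` (X \<inter> Y) \<in> tab_act u (\<pi> Y)" if "t \<in> u" for t
      using that u_dom(2)[OF that] unfolding tab_act_pid
      by (intro image_eqI[of _ _ t]) (metis restrict_restrict)
    then show ?thesis
      using join_le_iff[OF X(2) False tab_act_pid_subset[OF X(2)]] by auto
  qed (simp add: join_empty)
  show "(if schema G u = UNIV then u else tab_act u (\<pi> (schema G u))) = u"
    using schema_u u_dom by (cases "u = {}") (auto simp: tab_act_pid schema_empty)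
  show "u \<noteq> {} \<Longrightarrow> finite (schema G u)"
    using schema_u X(1) by simp
  show "schema G u = {x. join G u (diag G x x) = u}"
  proof (cases "u = {}")
    case False
    have "join G u (diag G x x) = u \<longleftrightarrow> x \<in> X" for x
      using join_le_iff[OF X(2) False diag_subset[of G x x]] X(2)
      by (auto simp: diag_refl intro: restrict_map_tuples)
    then show ?thesis using schema_u[OF False] by simp
  qed (simp add: join_empty schema_empty)
  show "u = join G (tab_act u (\<pi> (schema G u - {y}))) (diag G x y)"
    if "u \<noteq> {}" and le: "join G u (diag G x y) = u" and "x \<noteq> y" for x y
  proof -
    have xy: "x \<in> X" "y \<in> X" "\<forall>t\<in>u. t |` {x, y} \<in> diag G x y"
      using join_le_iff[OF X(2) that(1) diag_subset] le by auto
    then have eq: "t x = t y" if "t \<in> u" for t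
      using that by (auto simp: diag_def restrict_map_def)
    have sub: "tab_act u (\<pi> (X - {y})) \<subseteq> tuples G (X - {y})"
      using tab_act_pid_subset[OF X(2), of "X - {y}"] by (simp add: Int_absorb1)
    have dom: "(X - {y}) \<union> {x, y} = X" using xy by blast
    \<comment> \<open>Some s in u agrees with t off y. Both tuples take equal values at x and y, and
      x \<noteq> y keeps x among the retained columns, so they also agree at y; hence t = s.\<close>
    have mem: "t \<in> u" if t: "dom t = X" "t |` (X - {y}) \<in> tab_act u (\<pi> (X - {y}))"
      "t |` {x, y} \<in> diag G x y" for t
    proof -
      obtain s where s: "s \<in> u" "t |` (X - {y}) = s |` (X - {y})"
        using t(2) by (auto simp: tab_act_pid)
      have agree: "t z = s z" if "z \<in> X" "z \<noteq> y" for z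
        using fun_cong[OF s(2), of z] that by simp
      have "t x = t y" using t(3) by (auto simp: diag_def restrict_map_def)
      then have "t y = s y" using agree[of x] xy(1) eq[OF s(1)] \<open>x \<noteq> y\<close> by simp
      moreover have "t z = s z" if "z \<notin> X" for z
        using that t(1) u_dom(1)[OF s(1)] by (metis domIff)
      ultimately have "t = s" using agree by (intro ext) metis
      then show ?thesis using s(1) by simp
    qed
    show ?thesis
      unfolding schema_u[OF that(1)] join_eq[OF sub diag_subset] dom
    proof (intro equalityI subsetI)
      fix t assume "t \<in> u"
      then show "t \<in> {t. dom t = X \<and> t |` (X - {y}) \<in> tab_act u (\<pi> (X - {y})) \<and>
          t |` {x, y} \<in> diag G x y}"
        using xy(3) u_dom(1)[of t] by (simp add: tab_act_pid)
    qed (use mem in blast)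
  qed

  show "tab_act u f \<in> Tab G" if "f \<in> Tfp" for f
    using tab_act_subset[OF X(2)] finite_vimage_Tfp[OF that] by (rule TabI[rotated])
  show "tab_act (tab_act u f) g = tab_act u (f \<circ>\<^sub>m g)" for f g
    by (simp add: tab_act_eq image_image map_comp_assoc)
  show "schema G (tab_act u f) = f -` Some ` schema G u" if "u \<noteq> {}" for f
    using schema_eq[OF _ tab_act_subset[OF X(2)], of f] that
    by (simp add: schema_u tab_act_eq)

  fix v assume v: "v \<in> Tab G"
  then obtain Z where Z: "finite Z" "v \<subseteq> tuples G Z" by (rule TabE)
  show "join G u v \<in> Tab G"
    using join_subset[OF X(2) Z(2)] X(1) Z(1) by (intro TabI[of "X \<union> Z"]) auto
  show "join G u v = join G v u"
    unfolding join_eq[OF X(2) Z(2)] join_eq[OF Z(2) X(2)] by auto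
  show "tab_act (join G u v) (\<pi> Y) = join G u (tab_act v (\<pi> Y))"
    if "finite Y" "schema G u \<subseteq> Y" for Y
  proof (cases "u = {}")
    case False
    then show ?thesis
      using join_tab_act_pid[OF X(2) Z(2)] that(2) schema_u by simp
  qed (simp add: join_empty tab_act_empty)
  show "join G (tab_act u f) (tab_act v f) = tab_act u f"
    if "f \<in> Tfp" and le: "join G u v = u" for f
  proof (cases "u = {}")
    case False
    have sub: "Z \<subseteq> X" and mem: "\<forall>t\<in>u. t |` Z \<in> v"
      using join_le_iff[OF X(2) False Z(2)] le by auto
    \<comment> \<open>Restricting a composite to the preimage of Z amounts to restricting the outer
      map to Z, so the witness for t in v is carried along by f.\<close>
    have "(t \<circ>\<^sub>m f) |` (f -` Some ` Z) = (t |` Z) \<circ>\<^sub>m f" for t :: "'g tuple"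
      by (auto simp: fun_eq_iff map_comp_def restrict_map_def split: option.splits)
    then have "\<forall>s\<in>tab_act u f. s |` (f -` Some ` Z) \<in> tab_act v f"
      using mem by (auto simp: tab_act_eq)
    moreover have "tab_act u f \<noteq> {}" using False by (simp add: tab_act_eq)
    ultimately show ?thesis
      using join_le_iff[OF tab_act_subset[OF X(2)] _ tab_act_subset[OF Z(2)]] sub by blast
  qed (simp add: join_empty tab_act_empty)

  fix w assume "w \<in> Tab G"
  then obtain W where "w \<subseteq> tuples G W" by (rule TabE)
  then show "join G (join G u v) w = join G u (join G v w)"
    using join_assoc X(2) Z(2) by blast
qed

end
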